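(* Suppose that $P_0$ is a probability measure on $\mathbb R^d$ supported in $B_R(0)$ and that, for some fixed $t>0$, $$C_t:=\sup_{x\in\mathbb R^d}\left\lVert\langle x,Y-\bar y_{x,t}\rangle\right\rVert_{L^2(\mu_{x,t})}<\infty.$$ Then the doubling condition (UD) holds with $$D_{\mathrm{UD}}=2\exp\left(\frac{4e^tC_t^2}{(e^t-1)^2}+\frac{\Delta_0}{2(e^t-1)}\right),$$ where $\Delta_0:=\sup_{y\in \operatorname{supp}P_0}|y|^2-\inf_{y\in\operatorname{supp}P_0}|y|^2\leq R^2$. Consequently, for compactly supported targets $P_0$, the doubling condition (UD) is necessary and sufficient for a spatially uniform $L^2$ normal-fluctuation bound (that is, $C_t<\infty$) at any fixed positive time $t$. For families of targets with uniformly bounded support radii and fluctuation constants $C_t$, the equivalence preserves dimension-uniformity.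
   Context: For $t>0$ and $x\in\mathbb R^d$, $\mu_{x,t}$ is the posterior probability measure $$\mu_{x,t}(dy)\propto\exp\left(-\frac{|x-e^{-t/2}y|^2}{2(1-e^{-t})}\right)P_0(dy),$$ i.e. the conditional law of $X_0$ given $X_t=x$, where $X_t=e^{-t/2}X_0+\sqrt{1-e^{-t}}\,Z$ with $X_0\sim P_0$ and $Z\sim N(0,I_d)$ independent. $Y$ denotes a random variable with law $\mu_{x,t}$ and $\bar y_{x,t}=\mathbb E_{\mu_{x,t}}[Y]$. Doubling condition (UD). Let $M=\operatorname{supp}P_0$ (compact). For $\theta\in\mathbb S^{d-1}$ set $U_\theta(y)=\sup_{y'\in M}\langle\theta,y'\rangle-\langle\theta,y\rangle$ and $F_\theta(u)=P_0(\{y:U_\theta(y)\leq u\})$ for $u>0$. (UD) holds if there exists a constant $D_{\mathrm{UD}}\geq1$ such that $F_\theta(2u)\leq D_{\mathrm{UD}}F_\theta(u)$ for all $\theta\in\mathbb S^{d-1}$ and all $u>0$. When a family of targets $P_0^{(d)}$ in different ambient dimensions $d$ is considered, (UD) requires the same constant $D_{\mathrm{UD}}$ to work for every $d$ (dimension-uniformity). *)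

theory Defs
  imports "HOL-Probability.Probability"
begin

text \<open>
  \<open>\<real>\<^sup>d\<close> is the library's \<^const>\<open>Euclidean_space\<close> \<open>d\<close>: sequences vanishing from index \<open>d\<close> on.
  The dimension is a term and not a type, so that one statement can speak about a family of
  measures living in different dimensions.
\<close>

abbreviation Rn :: "nat \<Rightarrow> (nat \<Rightarrow> real) set" where
  "Rn d \<equiv> topspace (Euclidean_space d)"

definition borel_Rn :: "nat \<Rightarrow> (nat \<Rightarrow> real) measure" where
  "borel_Rn d = sigma (Rn d) {U. openin (Euclidean_space d) U}"

definition inner_Rn :: "nat \<Rightarrow> (nat \<Rightarrow> real) \<Rightarrow> (nat \<Rightarrow> real) \<Rightarrow> real" where
  "inner_Rn d x y = (\<Sum>i<d. x i * y i)"

abbreviation norm_Rn :: "nat \<Rightarrow> (nat \<Rightarrow> real) \<Rightarrow> real" where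
  "norm_Rn d x \<equiv> L2_set x {..<d}"

definition cball_Rn :: "nat \<Rightarrow> real \<Rightarrow> (nat \<Rightarrow> real) set" where
  "cball_Rn d R = {x \<in> Rn d. norm_Rn d x \<le> R}"

definition sphere_Rn :: "nat \<Rightarrow> (nat \<Rightarrow> real) set" where
  "sphere_Rn d = {x \<in> Rn d. norm_Rn d x = 1}"

definition prob_Rn :: "nat \<Rightarrow> (nat \<Rightarrow> real) measure \<Rightarrow> bool" where
  "prob_Rn d P \<longleftrightarrow> prob_space P \<and> sets P = sets (borel_Rn d)"

definition supp_Rn :: "nat \<Rightarrow> (nat \<Rightarrow> real) measure \<Rightarrow> (nat \<Rightarrow> real) set" where
  "supp_Rn d P = {x \<in> Rn d. \<forall>U. openin (Euclidean_space d) U \<and> x \<in> U \<longrightarrow> 0 < measure P U}"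

definition post_weight :: "nat \<Rightarrow> real \<Rightarrow> (nat \<Rightarrow> real) \<Rightarrow> (nat \<Rightarrow> real) \<Rightarrow> real" where
  "post_weight d t x y =
     exp (- (norm_Rn d (\<lambda>i. x i - exp (- t / 2) * y i))\<^sup>2 / (2 * (1 - exp (- t))))"

definition posterior ::
    "nat \<Rightarrow> (nat \<Rightarrow> real) measure \<Rightarrow> (nat \<Rightarrow> real) \<Rightarrow> real \<Rightarrow> (nat \<Rightarrow> real) measure" where
  "posterior d P x t =
     density P (\<lambda>y. ennreal (post_weight d t x y) / (\<integral>\<^sup>+ z. ennreal (post_weight d t x z) \<partial>P))"

text \<open>
  The mean is taken coordinatewise. As with every Bochner integral, it is meaningful only if the
  coordinates are integrable, which holds for all boundedly supported \<open>P\<close>.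
\<close>

definition post_mean ::
    "nat \<Rightarrow> (nat \<Rightarrow> real) measure \<Rightarrow> (nat \<Rightarrow> real) \<Rightarrow> real \<Rightarrow> (nat \<Rightarrow> real)" where
  "post_mean d P x t = (\<lambda>i. \<integral>y. y i \<partial>posterior d P x t)"

text \<open>The \<open>L\<^sup>2\<close> norm takes the value \<open>\<infinity>\<close> on functions that are not square integrable.\<close>

definition L2_norm :: "'a measure \<Rightarrow> ('a \<Rightarrow> real) \<Rightarrow> ennreal" where
  "L2_norm M f =
     (let I = \<integral>\<^sup>+ y. ennreal ((f y)\<^sup>2) \<partial>M
      in if I = \<infinity> then \<infinity> else ennreal (sqrt (enn2real I)))"

definition fluct_const :: "nat \<Rightarrow> (nat \<Rightarrow> real) measure \<Rightarrow> real \<Rightarrow> ennreal" where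
  "fluct_const d P t =
     (SUP x \<in> Rn d. L2_norm (posterior d P x t)
                      (\<lambda>y. inner_Rn d x (\<lambda>i. y i - post_mean d P x t i)))"

definition depth ::
    "nat \<Rightarrow> (nat \<Rightarrow> real) measure \<Rightarrow> (nat \<Rightarrow> real) \<Rightarrow> (nat \<Rightarrow> real) \<Rightarrow> real" where
  "depth d P \<theta> y = (SUP y' \<in> supp_Rn d P. inner_Rn d \<theta> y') - inner_Rn d \<theta> y"

definition depth_cdf ::
    "nat \<Rightarrow> (nat \<Rightarrow> real) measure \<Rightarrow> (nat \<Rightarrow> real) \<Rightarrow> real \<Rightarrow> real" where
  "depth_cdf d P \<theta> u = measure P {y \<in> space P. depth d P \<theta> y \<le> u}"

definition UD_with :: "nat \<Rightarrow> (nat \<Rightarrow> real) measure \<Rightarrow> real \<Rightarrow> bool" where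
  "UD_with d P D \<longleftrightarrow>
     1 \<le> D \<and> (\<forall>\<theta> \<in> sphere_Rn d. \<forall>u > 0. depth_cdf d P \<theta> (2 * u) \<le> D * depth_cdf d P \<theta> u)"

definition UD :: "nat \<Rightarrow> (nat \<Rightarrow> real) measure \<Rightarrow> bool" where
  "UD d P \<longleftrightarrow> (\<exists>D. UD_with d P D)"

definition UD_family :: "'i set \<Rightarrow> ('i \<Rightarrow> nat) \<Rightarrow> ('i \<Rightarrow> (nat \<Rightarrow> real) measure) \<Rightarrow> bool" where
  "UD_family I dm P \<longleftrightarrow> (\<exists>D. \<forall>i \<in> I. UD_with (dm i) (P i) D)"

definition norm_gap :: "nat \<Rightarrow> (nat \<Rightarrow> real) measure \<Rightarrow> real" where
  "norm_gap d P =
     (SUP y \<in> supp_Rn d P. (norm_Rn d y)\<^sup>2) - (INF y \<in> supp_Rn d P. (norm_Rn d y)\<^sup>2)"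

end

theory Submission
  imports Defs "HOL-Real_Asymp.Real_Asymp"
begin

text \<open>
  Write \<open>x = r \<theta>\<close> with a unit vector \<open>\<theta>\<close>. Expanding the square, the posterior becomes the measure
  \<open>exp (- s U) dQ\<close>, normalised, where \<open>U\<close> is the depth in direction \<open>\<theta>\<close>, \<open>dQ = exp (- c |y|\<^sup>2) dP\<close> with
  \<open>c = 1 / (2 (e\<^sup>t - 1))\<close>, and \<open>s = r e\<^bsup>t/2\<^esup> / (e\<^sup>t - 1)\<close>; the fluctuation of \<open>\<langle>x, Y\<rangle>\<close> is \<open>r\<close> times
  the standard deviation of \<open>U\<close>. Passing between \<open>P\<close> and \<open>Q\<close> changes doubling constants by at most
  \<open>exp (c \<Delta>\<^sub>0)\<close>.

  If \<open>s\<^sup>2 Var\<^sub>s U \<le> K\<close> for all \<open>s > 0\<close>, then integrating \<open>(E\<^sub>s U)' = - Var\<^sub>s U\<close> from \<open>s\<close> to infinity,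
  where \<open>E\<^sub>s U\<close> vanishes, gives \<open>E\<^sub>s U \<le> K / s\<close>. For \<open>s = 2 K / u\<close>, Markov's inequality puts at least
  half of the tilted mass on \<open>U \<le> u\<close>, whence \<open>Q (U \<le> 2 u) \<le> 2 e\<^bsup>4K\<^esup> Q (U \<le> u)\<close>.

  Conversely, doubling bounds \<open>s\<^sup>2 E\<^sub>s U\<^sup>2\<close> by a dyadic decomposition of \<open>U\<close> at scale \<open>1 / s\<close>: the
  shell \<open>s U \<approx> 2\<^sup>k\<close> contributes at most \<open>(4 D)\<^sup>k exp (- 2\<^sup>k / 2)\<close>, up to a constant.
\<close>

section \<open>Exponential tilts of a bounded function\<close>

lemma abs_exp_linear_remainder_le:
  fixes z :: real
  assumes "z \<le> 1"
  shows "\<bar>exp z - 1 - z\<bar> \<le> z\<^sup>2"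
proof (cases "0 \<le> z")
  case True
  then show ?thesis
    using exp_bound[of z] exp_ge_add_one_self[of z] assms zero_le_power2[of z]
    unfolding abs_le_iff by linarith
next
  case False
  have "(1 - z) \<le> exp (- z)"
    using exp_ge_add_one_self[of "- z"] by simp
  then have "exp z * (1 - z) \<le> exp z * exp (- z)"
    by simp
  then have "exp z * (1 - z) \<le> 1"
    by (simp flip: exp_add)
  \<comment> \<open>The product equals \<open>1 - z ^ 3\<close>, which is at least 1 for negative
    \<open>z\<close>; cancelling the positive factor \<open>1 - z\<close> then bounds
    \<open>exp z\<close>.\<close>
  also have "1 \<le> (1 + z + z\<^sup>2) * (1 - z)"
    using False zero_le_power2[of z] by (simp add: algebra_simps power2_eq_square mult_nonpos_nonneg)
  finally have "exp z \<le> 1 + z + z\<^sup>2"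
    using False by simp
  then show ?thesis
    using exp_ge_add_one_self[of z] zero_le_power2[of z] unfolding abs_le_iff by linarith
qed

text \<open>The term of the least \<open>k\<close> with \<open>v \<le> 2 ^ k\<close> already
  suffices: there \<open>v\<close> squared is at most \<open>4 ^ k\<close>, and for
  \<open>k > 0\<close> also \<open>v > 2 ^ k / 2\<close>. The extra factor \<open>exp 1\<close>
  absorbs the crude bound 1 used at \<open>k = 0\<close>. Sublevel sets replace shells because
  doubling controls the former.\<close>

lemma dyadic_bound_square_exp:
  fixes v :: real
  assumes "0 \<le> v" "v \<le> 2 ^ n"
  shows "v\<^sup>2 * exp (- v) \<le> (\<Sum>k\<le>n. 4 ^ k * exp (1 - 2 ^ k / 2) * (if v \<le> 2 ^ k then 1 else 0))"
  using assms
proof (induction n)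
  case 0
  then have "v\<^sup>2 * exp (- v) \<le> 1 * 1"
    by (intro mult_mono) (auto simp: power_le_one)
  also have "(1::real) * 1 \<le> exp (1 / 2)" by simp
  finally show ?case using 0 by simp
next
  case (Suc n)
  let ?g = "\<lambda>k. 4 ^ k * exp (1 - 2 ^ k / 2) * (if v \<le> 2 ^ k then 1 else 0)"
  show ?case
  proof (cases "v \<le> 2 ^ n")
    case True
    then have "v\<^sup>2 * exp (- v) \<le> (\<Sum>k\<le>n. ?g k)" using Suc by simp
    also have "\<dots> \<le> (\<Sum>k\<le>Suc n. ?g k)" by simp
    finally show ?thesis .
  next
    case False
    have "v\<^sup>2 * exp (- v) \<le> (2 ^ Suc n)\<^sup>2 * exp (1 - 2 ^ Suc n / 2)"
      using False Suc.prems by (intro mult_mono power_mono) auto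
    also have "\<dots> = ?g (Suc n)"
      using Suc.prems power_mult_distrib[of "2::real" 2 n] by (simp add: power2_eq_square mult_ac)
    also have "\<dots> \<le> (\<Sum>k\<le>Suc n. ?g k)"
      by (simp add: sum_nonneg)
    finally show ?thesis .
  qed
qed

text \<open>The total weight of the \<open>k\<close>-th dyadic level: \<open>D ^ k\<close> is the
  price of \<open>k\<close> doublings, the rest is the coefficient in
  \<open>dyadic_bound_square_exp\<close>.\<close>

definition doubling_series :: "real \<Rightarrow> nat \<Rightarrow> real" where
  "doubling_series D k = (4 * D) ^ k * exp (1 - 2 ^ k / 2)"

text \<open>The ratio of consecutive terms is \<open>4 * D * exp (- (2 ^ k / 2))\<close>, which
  tends to 0: doubly exponential decay beats the geometric growth.\<close>

lemma summable_doubling_series: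
  assumes "1 \<le> D"
  shows "summable (doubling_series D)"
proof -
  have "\<forall>\<^sub>F k in sequentially. 4 * D * exp (- (2 ^ k / 2)) \<le> 1 / 2"
    using assms by real_asymp
  then obtain N where N: "4 * D * exp (- (2 ^ k / 2)) \<le> 1 / 2" if "N \<le> k" for k
    by (auto simp: eventually_sequentially)
  show ?thesis
  proof (rule summable_ratio_test[where c = "1 / 2"])
    fix k assume "N \<le> k"
    have "doubling_series D (Suc k) = 4 * D * exp (- (2 ^ k / 2)) * doubling_series D k"
      by (simp add: doubling_series_def mult_ac flip: exp_add)
    also have "\<dots> \<le> 1 / 2 * doubling_series D k"
      using N[OF \<open>N \<le> k\<close>] assms by (intro mult_right_mono) (auto simp: doubling_series_def)
    finally show "norm (doubling_series D (Suc k)) \<le> 1 / 2 * norm (doubling_series D k)"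
      using assms by (simp add: doubling_series_def)
  qed simp
qed

text \<open>An abstract setting for the depth in one fixed direction. The assumption
  \<open>mass_near_zero\<close> says that the lower bound 0 of \<open>U\<close> is approached with
  positive mass; it makes the normalising constant positive and drives the tilted mean to 0.\<close>

locale exponential_tilt = finite_measure Q for Q :: "'a measure" +
  fixes U :: "'a \<Rightarrow> real" and B :: real
  assumes U_measurable [measurable]: "U \<in> borel_measurable Q"
    and U_bounds: "AE y in Q. 0 \<le> U y \<and> U y \<le> B"
    and mass_near_zero: "\<And>\<epsilon>. 0 < \<epsilon> \<Longrightarrow> 0 < measure Q {y \<in> space Q. U y \<le> \<epsilon>}"
begin

definition tmoment :: "nat \<Rightarrow> real \<Rightarrow> real" where
  "tmoment k s = (\<integral>y. U y ^ k * exp (- s * U y) \<partial>Q)"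

definition tmean :: "real \<Rightarrow> real" where
  "tmean s = tmoment 1 s / tmoment 0 s"

definition tvar :: "real \<Rightarrow> real" where
  "tvar s = tmoment 2 s / tmoment 0 s - (tmean s)\<^sup>2"

section \<open>Integrability, positivity and differentiation of the moments\<close>

lemma measurable_sublevel [measurable]: "{y \<in> space Q. U y \<le> u} \<in> sets Q"
  by measurable

text \<open>A negative \<open>B\<close> would make \<open>U_bounds\<close> contradictory almost
  everywhere, so \<open>Q\<close> would be the null measure, against
  \<open>mass_near_zero\<close>.\<close>

lemma B_nonneg: "0 \<le> B"
proof (rule ccontr)
  assume "\<not> 0 \<le> B"
  then have "AE y in Q. False"
    using U_bounds by (auto elim: eventually_mono)
  then have "emeasure Q (space Q) = 0"
    using ae_filter_eq_bot_iff trivial_limit_def by metis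
  then have "measure Q {y \<in> space Q. U y \<le> 1} \<le> 0"
    using finite_measure_mono[of "{y \<in> space Q. U y \<le> 1}" "space Q"] by (auto simp: measure_def)
  then show False
    using mass_near_zero[of 1] by simp
qed

lemma integrable_tmoment [simp]: "integrable Q (\<lambda>y. U y ^ k * exp (- s * U y))"
proof (rule integrable_const_bound[where B = "B ^ k * exp (\<bar>s\<bar> * B)"])
  show "AE y in Q. norm (U y ^ k * exp (- s * U y)) \<le> B ^ k * exp (\<bar>s\<bar> * B)"
    using U_bounds
  proof eventually_elim
    case (elim y)
    have "- s * U y \<le> \<bar>s\<bar> * B"
      using elim by (intro mult_mono) auto
    then show ?case
      using elim by (auto simp: abs_mult intro!: mult_mono power_mono)
  qed
qed measurable

lemma tmoment_nonneg: "0 \<le> tmoment k s"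
  unfolding tmoment_def using U_bounds by (intro integral_nonneg_AE) (auto elim: eventually_mono)

text \<open>Exponential Markov inequality: on the sublevel set the integrand is at least
  \<open>exp (- s * u)\<close>. Both directions of the equivalence compare the normalising constant
  with sublevel masses through it.\<close>

lemma tmoment_0_ge:
  assumes "0 \<le> s"
  shows "exp (- s * u) * measure Q {y \<in> space Q. U y \<le> u} \<le> tmoment 0 s"
proof -
  have "exp (- s * u) * measure Q {y \<in> space Q. U y \<le> u} =
      (\<integral>y. exp (- s * u) * indicator {y \<in> space Q. U y \<le> u} y \<partial>Q)"
    by (simp add: emeasure_eq_measure)
  also have "\<dots> \<le> tmoment 0 s"
    unfolding tmoment_def
    using assms integrable_tmoment[of 0 s]
    by (intro integral_mono integrable_mult_right integrable_real_indicator)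
       (auto simp: emeasure_eq_measure indicator_def mult_left_mono)
  finally show ?thesis .
qed

lemma tmoment_0_pos:
  assumes "0 \<le> s"
  shows "0 < tmoment 0 s"
  using tmoment_0_ge[OF assms, of 1] mass_near_zero[of 1]
  by (smt (verit) exp_gt_zero mult_pos_pos)

text \<open>Differentiation under the integral by a direct estimate: for small \<open>h\<close> the
  second-order remainder is pointwise at most the square of \<open>h * U y\<close> times the
  integrand, so the difference quotient errs by at most
  \<open>\<bar>h\<bar> * tmoment (k + 2) s\<close>.\<close>

lemma DERIV_tmoment: "(tmoment k has_real_derivative - tmoment (Suc k) s) (at s)"
  unfolding DERIV_def
proof (rule LIM_zero_cancel, rule Lim_null_comparison)
  have "\<forall>\<^sub>F h in at 0. \<bar>h\<bar> < inverse (B + 1) \<and> h \<noteq> 0"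
    using B_nonneg unfolding eventually_at
    by (intro exI[of _ "inverse (B + 1)"]) (auto simp: dist_real_def)
  then show "\<forall>\<^sub>F h in at 0. norm ((tmoment k (s + h) - tmoment k s) / h - - tmoment (Suc k) s)
      \<le> \<bar>h\<bar> * tmoment (k + 2) s"
  proof eventually_elim
    case (elim h)
    let ?f = "\<lambda>k s y. U y ^ k * exp (- s * U y)"
    \<comment> \<open>This yields \<open>- (h * U y) \<le> 1\<close>, the hypothesis of the
      remainder bound. The radius \<open>inverse (B + 1)\<close> is positive also when
      \<open>B = 0\<close>.\<close>
    have hB: "\<bar>h\<bar> * B \<le> 1"
    proof -
      have "\<bar>h\<bar> * B \<le> inverse (B + 1) * (B + 1)"
        using elim B_nonneg by (intro mult_mono) auto
      then show ?thesis using B_nonneg by simp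
    qed
    have "\<bar>tmoment k (s + h) - tmoment k s + h * tmoment (Suc k) s\<bar> =
        \<bar>\<integral>y. ?f k (s + h) y - ?f k s y + h * ?f (Suc k) s y \<partial>Q\<bar>"
      unfolding tmoment_def
      using integrable_tmoment[of k "s + h"] integrable_tmoment[of k s] integrable_tmoment[of "Suc k" s]
      by (simp del: integrable_tmoment power_Suc)
    also have "\<dots> \<le> (\<integral>y. \<bar>?f k (s + h) y - ?f k s y + h * ?f (Suc k) s y\<bar> \<partial>Q)"
      by (rule integral_abs_bound)
    also have "\<dots> \<le> (\<integral>y. h\<^sup>2 * ?f (k + 2) s y \<partial>Q)"
    proof (rule integral_mono_AE)
      show "integrable Q (\<lambda>y. \<bar>?f k (s + h) y - ?f k s y + h * ?f (Suc k) s y\<bar>)"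
        by (intro integrable_abs Bochner_Integration.integrable_add
            Bochner_Integration.integrable_diff integrable_mult_right integrable_tmoment)
      show "AE y in Q. \<bar>?f k (s + h) y - ?f k s y + h * ?f (Suc k) s y\<bar> \<le> h\<^sup>2 * ?f (k + 2) s y"
        using U_bounds
      proof eventually_elim
        case U: (elim y)
        have "\<bar>h * U y\<bar> \<le> \<bar>h\<bar> * B"
          using U by (auto simp: abs_mult intro!: mult_left_mono)
        then have "- (h * U y) \<le> 1"
          using hB by linarith
        from abs_exp_linear_remainder_le[OF this]
        have *: "\<bar>exp (- (h * U y)) - 1 + h * U y\<bar> \<le> (h * U y)\<^sup>2"
          by simp
        have "?f k (s + h) y - ?f k s y + h * ?f (Suc k) s y =
            ?f k s y * (exp (- (h * U y)) - 1 + h * U y)"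
          by (simp add: algebra_simps exp_add exp_diff exp_minus divide_inverse)
        also have "\<bar>\<dots>\<bar> \<le> ?f k s y * (h * U y)\<^sup>2"
          unfolding abs_mult using U * by (intro mult_mono) auto
        finally show ?case
          by (simp add: power_mult_distrib power_add power2_eq_square mult_ac)
      qed
    qed (intro integrable_mult_right integrable_tmoment)
    also have "\<dots> = h\<^sup>2 * tmoment (k + 2) s"
      unfolding tmoment_def by (rule integral_mult_right_zero)
    finally have "\<bar>tmoment k (s + h) - tmoment k s + h * tmoment (Suc k) s\<bar> / \<bar>h\<bar>
        \<le> h\<^sup>2 * tmoment (k + 2) s / \<bar>h\<bar>"
      by (rule divide_right_mono) simp
    moreover have "\<bar>tmoment k (s + h) - tmoment k s + h * tmoment (Suc k) s\<bar> / \<bar>h\<bar> =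
        norm ((tmoment k (s + h) - tmoment k s) / h - - tmoment (Suc k) s)"
      using elim by (simp add: add_divide_distrib flip: abs_divide)
    moreover have "h\<^sup>2 * tmoment (k + 2) s / \<bar>h\<bar> = \<bar>h\<bar> * tmoment (k + 2) s"
      using elim by (simp add: power2_eq_square divide_simps)
    ultimately show ?case
      by simp
  qed
  show "((\<lambda>h. \<bar>h\<bar> * tmoment (k + 2) s) \<longlongrightarrow> 0) (at 0)"
    by (auto intro!: tendsto_eq_intros)
qed

section \<open>The tilted mean, and doubling from a variance bound\<close>

lemma tmean_nonneg: "0 \<le> tmean s"
  unfolding tmean_def by (simp add: tmoment_nonneg)

text \<open>The quotient rule applied to \<open>tmoment 1 / tmoment 0\<close>: differentiating the
  first cumulant in \<open>s\<close> gives minus the second.\<close>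

lemma DERIV_tmean:
  assumes "0 < s"
  shows "(tmean has_real_derivative - tvar s) (at s)"
proof -
  have "tmoment 0 s \<noteq> 0"
    using tmoment_0_pos[of s] assms by simp
  from DERIV_quotient[OF DERIV_tmoment[of 1 s] DERIV_tmoment[of 0 s] this]
  show ?thesis
    unfolding tmean_def tvar_def
    by (rule DERIV_cong)
       (use \<open>tmoment 0 s \<noteq> 0\<close> in \<open>simp add: tmean_def field_simps power2_eq_square numeral_2_eq_2\<close>)
qed

text \<open>The part \<open>U \<le> \<epsilon>\<close> contributes at most \<open>\<epsilon>\<close>
  to the mean. The rest has unnormalised weight of order \<open>exp (- s * \<epsilon>)\<close>,
  while the normalising constant is at least of the larger order
  \<open>exp (- s * (\<epsilon> / 2))\<close>.\<close>

lemma tmean_tendsto_0: "(tmean \<longlongrightarrow> 0) at_top"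
proof (rule order_tendstoI)
  fix a :: real
  assume "a < 0"
  then show "\<forall>\<^sub>F s in at_top. a < tmean s"
    using tmean_nonneg by (intro always_eventually allI) (rule less_le_trans)
next
  fix a :: real
  assume "0 < a"
  define \<epsilon> where "\<epsilon> = a / 2"
  \<comment> \<open>The level \<open>\<epsilon> / 2\<close> is strictly below the cut at
    \<open>\<epsilon>\<close>, which leaves a decaying factor in the quotient;
    \<open>\<epsilon> = a / 2\<close> keeps the limit strictly below \<open>a\<close>.\<close>
  define q where "q = measure Q {y \<in> space Q. U y \<le> \<epsilon> / 2}"
  have "0 < \<epsilon>" using \<open>0 < a\<close> by (simp add: \<epsilon>_def)
  then have "0 < q" unfolding q_def by (intro mass_near_zero) simp
  define m where "m = measure Q (space Q)"
  have bound: "tmean s \<le> \<epsilon> + B * m / q * exp (- s * (\<epsilon> / 2))" if "0 < s" for s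
  proof -
    have Z: "exp (- s * (\<epsilon> / 2)) * q \<le> tmoment 0 s"
      unfolding q_def using that by (intro tmoment_0_ge) simp
    have Z0: "0 < tmoment 0 s" using that by (intro tmoment_0_pos) simp
    have "tmoment 1 s \<le> (\<integral>y. \<epsilon> * (U y ^ 0 * exp (- s * U y)) + B * exp (- s * \<epsilon>) \<partial>Q)"
      unfolding tmoment_def
    proof (rule integral_mono_AE)
      show "AE y in Q. U y ^ 1 * exp (- s * U y) \<le> \<epsilon> * (U y ^ 0 * exp (- s * U y)) + B * exp (- s * \<epsilon>)"
        using U_bounds
      proof eventually_elim
        case (elim y)
        show ?case
        proof (cases "U y \<le> \<epsilon>")
          case True
          then have "U y * exp (- s * U y) \<le> \<epsilon> * exp (- s * U y)"
            by (intro mult_right_mono) auto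
          then show ?thesis using B_nonneg by (simp add: add_increasing2)
        next
          case False
          then have "U y * exp (- s * U y) \<le> B * exp (- s * \<epsilon>)"
            using elim that B_nonneg by (intro mult_mono) auto
          then show ?thesis using \<open>0 < \<epsilon>\<close> by (simp add: add_increasing)
        qed
      qed
    qed (intro integrable_tmoment Bochner_Integration.integrable_add integrable_mult_right
        integrable_const)+
    also have "\<dots> = \<epsilon> * tmoment 0 s + B * exp (- s * \<epsilon>) * m"
      unfolding tmoment_def m_def
      using integrable_tmoment[of 0 s] by simp
    finally have "tmean s \<le> \<epsilon> + B * m * exp (- s * \<epsilon>) / tmoment 0 s"
      unfolding tmean_def using Z0 by (simp add: field_simps)
    also have "B * m * exp (- s * \<epsilon>) / tmoment 0 s \<le> B * m * exp (- s * \<epsilon>) / (exp (- s * (\<epsilon> / 2)) * q)"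
      using Z Z0 \<open>0 < q\<close> B_nonneg by (intro divide_left_mono) (auto simp: m_def)
    also have "\<dots> = B * m / q * exp (- s * (\<epsilon> / 2))"
      using \<open>0 < q\<close> by (simp add: field_simps flip: exp_add)
    finally show ?thesis by simp
  qed
  have "((\<lambda>s. \<epsilon> + B * m / q * exp (- s * (\<epsilon> / 2))) \<longlongrightarrow> \<epsilon> + B * m / q * 0) at_top"
    using \<open>0 < \<epsilon>\<close> by (intro tendsto_intros) real_asymp
  then have "\<forall>\<^sub>F s in at_top. \<epsilon> + B * m / q * exp (- s * (\<epsilon> / 2)) < a"
    by (rule order_tendstoD) (use \<open>0 < a\<close> in \<open>simp add: \<epsilon>_def\<close>)
  then show "\<forall>\<^sub>F s in at_top. tmean s < a"
    using eventually_gt_at_top[of 0] by eventually_elim (use bound in force)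
qed

text \<open>Since \<open>tmean' = - tvar\<close>, the function \<open>tmean s - K / s\<close> is increasing, and it vanishes at infinity.\<close>

lemma tmean_le_of_tvar_le:
  assumes "\<And>s. 0 < s \<Longrightarrow> s\<^sup>2 * tvar s \<le> K" and "0 < s"
  shows "tmean s \<le> K / s"
proof -
  define h where "h = (\<lambda>s. tmean s - K / s)"
  have "h s \<le> h r" if "s \<le> r" for r
  proof (rule DERIV_nonneg_imp_nondecreasing[OF that])
    fix x assume "s \<le> x" "x \<le> r"
    then have "0 < x" using \<open>0 < s\<close> by simp
    have "(h has_real_derivative (- tvar x - (- K / x\<^sup>2))) (at x)"
      unfolding h_def using DERIV_tmean[OF \<open>0 < x\<close>] \<open>0 < x\<close>
      by (auto intro!: derivative_eq_intros simp: power2_eq_square)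
    moreover have "0 \<le> - tvar x - (- K / x\<^sup>2)"
      using assms(1)[OF \<open>0 < x\<close>] \<open>0 < x\<close> by (simp add: field_simps)
    ultimately show "\<exists>y. (h has_real_derivative y) (at x) \<and> 0 \<le> y" by blast
  qed
  then have "\<forall>\<^sub>F r in at_top. h s \<le> h r"
    by (rule eventually_mono[OF eventually_ge_at_top])
  moreover have "(h \<longlongrightarrow> 0 - 0) at_top"
    unfolding h_def by (intro tendsto_diff tmean_tendsto_0) real_asymp
  ultimately have "h s \<le> 0"
    by (intro tendsto_lowerbound[of h 0 at_top]) auto
  then show ?thesis by (simp add: h_def)
qed

text \<open>The normalising constant is squeezed between two sublevel masses: it is at most
  \<open>2 * ?F u\<close>, because the tilted mean is at most \<open>u / 2\<close>, and at least
  \<open>exp (- s * (2 * u)) * ?F (2 * u)\<close> by \<open>tmoment_0_ge\<close>.\<close>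

lemma doubling_of_tvar_le:
  assumes K: "\<And>s. 0 < s \<Longrightarrow> s\<^sup>2 * tvar s \<le> K" and u: "0 < u"
  shows "measure Q {y \<in> space Q. U y \<le> 2 * u} \<le> 2 * exp (4 * K) * measure Q {y \<in> space Q. U y \<le> u}"
proof -
  let ?F = "\<lambda>u. measure Q {y \<in> space Q. U y \<le> u}"
  have "0 \<le> K"
    using tmean_le_of_tvar_le[OF K, of 1] tmean_nonneg[of 1] by simp
  \<comment> \<open>The critical value \<open>2 * K / u\<close> is 0 when \<open>K = 0\<close>,
    whereas the mean bound asks for positive \<open>s\<close>. The estimate is therefore proved for
    all positive \<open>s\<close> from there on and passed to the limit afterwards.\<close>
  have *: "?F (2 * u) \<le> 2 * exp (2 * u * s) * ?F u" if s: "2 * K / u \<le> s" "0 < s" for s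
  proof -
    have "0 < tmoment 0 s" using s by (intro tmoment_0_pos) simp
    have "2 * K \<le> s * u" using s u by (simp add: field_simps)
    have "tmoment 1 s \<le> K / s * tmoment 0 s"
      using tmean_le_of_tvar_le[OF K \<open>0 < s\<close>] \<open>0 < tmoment 0 s\<close>
      unfolding tmean_def by (simp add: field_simps)
    also have "\<dots> \<le> u / 2 * tmoment 0 s"
      using \<open>0 < tmoment 0 s\<close> s \<open>2 * K \<le> s * u\<close> by (intro mult_right_mono) (auto simp: field_simps)
    finally have mean: "tmoment 1 s / u \<le> tmoment 0 s / 2"
      using u by (simp add: field_simps)
    \<comment> \<open>Markov's inequality pointwise: the weight is at most 1 where
      \<open>U y \<le> u\<close>, and elsewhere at most \<open>U y / u\<close> times itself.\<close>
    have "tmoment 0 s \<le> (\<integral>y. indicator {y \<in> space Q. U y \<le> u} y + inverse u * (U y ^ 1 * exp (- s * U y)) \<partial>Q)"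
      unfolding tmoment_def
    proof (rule integral_mono_AE)
      show "AE y in Q. U y ^ 0 * exp (- s * U y) \<le>
          indicator {y \<in> space Q. U y \<le> u} y + inverse u * (U y ^ 1 * exp (- s * U y))"
        using U_bounds AE_space
      proof eventually_elim
        case (elim y)
        show ?case
        proof (cases "U y \<le> u")
          case True
          then show ?thesis using elim u s by (simp add: add_increasing2)
        next
          case False
          then have "1 \<le> inverse u * U y" using u by (simp add: field_simps)
          then have "1 * exp (- s * U y) \<le> (inverse u * U y) * exp (- s * U y)"
            by (intro mult_right_mono) auto
          then show ?thesis using False by (simp add: mult.assoc)
        qed
      qed
    qed (intro integrable_tmoment Bochner_Integration.integrable_add integrable_mult_right
          integrable_real_indicator measurable_sublevel | simp add: emeasure_eq_measure)+
    also have "\<dots> = ?F u + inverse u * (\<integral>y. U y ^ 1 * exp (- s * U y) \<partial>Q)"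
      using integrable_tmoment[of 1 s]
      by (subst Bochner_Integration.integral_add)
         (auto intro!: integrable_real_indicator simp: emeasure_eq_measure)
    also have "\<dots> = ?F u + tmoment 1 s / u"
      by (simp add: tmoment_def field_simps)
    finally have half: "tmoment 0 s \<le> 2 * ?F u"
      using mean by linarith
    have "?F (2 * u) = exp (2 * u * s) * (exp (- s * (2 * u)) * ?F (2 * u))"
      by (simp add: mult.commute flip: exp_add mult.assoc)
    also have "\<dots> \<le> exp (2 * u * s) * tmoment 0 s"
      using s by (intro mult_left_mono tmoment_0_ge) auto
    also have "\<dots> \<le> exp (2 * u * s) * (2 * ?F u)"
      using half by (intro mult_left_mono) auto
    finally show ?thesis by simp
  qed
  \<comment> \<open>In the limit from the right the exponent \<open>2 * u * s\<close> becomes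
    \<open>4 * K\<close>.\<close>
  have "((\<lambda>s. 2 * exp (2 * u * s) * ?F u) \<longlongrightarrow> 2 * exp (2 * u * (2 * K / u)) * ?F u) (at_right (2 * K / u))"
    by (intro tendsto_intros)
  moreover have "\<forall>\<^sub>F s in at_right (2 * K / u). ?F (2 * u) \<le> 2 * exp (2 * u * s) * ?F u"
    using eventually_at_right_less
  proof eventually_elim
    case (elim s)
    moreover have "0 \<le> 2 * K / u" using \<open>0 \<le> K\<close> u by simp
    ultimately show ?case by (intro *) linarith+
  qed
  ultimately have "?F (2 * u) \<le> 2 * exp (2 * u * (2 * K / u)) * ?F u"
    by (rule tendsto_lowerbound) simp
  then show ?thesis using u by simp
qed

section \<open>A second-moment bound from doubling\<close>

lemma measure_dyadic_le:
  assumes "\<And>u. 0 < u \<Longrightarrow>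
      measure Q {y \<in> space Q. U y \<le> 2 * u} \<le> D * measure Q {y \<in> space Q. U y \<le> u}"
    and "0 \<le> D" "0 < u"
  shows "measure Q {y \<in> space Q. U y \<le> 2 ^ k * u} \<le> D ^ k * measure Q {y \<in> space Q. U y \<le> u}"
proof (induction k)
  case (Suc k)
  have "measure Q {y \<in> space Q. U y \<le> 2 ^ Suc k * u} \<le> D * measure Q {y \<in> space Q. U y \<le> 2 ^ k * u}"
    using assms(1)[of "2 ^ k * u"] \<open>0 < u\<close> by (simp add: mult.assoc)
  also have "\<dots> \<le> D * (D ^ k * measure Q {y \<in> space Q. U y \<le> u})"
    using Suc \<open>0 \<le> D\<close> by (rule mult_left_mono)
  finally show ?case by (simp add: mult.assoc)
qed simp

text \<open>The dyadic bound is applied to \<open>v = s * U y\<close>, so the base scale is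
  \<open>1 / s\<close>. Doubling reduces every level to \<open>?F (1 / s)\<close>, and
  \<open>tmoment_0_ge\<close> at \<open>u = 1 / s\<close> bounds that by
  \<open>exp 1 * tmoment 0 s\<close>. The resulting factor depends on \<open>D\<close>
  alone.\<close>

lemma tmoment_2_le_of_doubling:
  assumes doubling: "\<And>u. 0 < u \<Longrightarrow>
      measure Q {y \<in> space Q. U y \<le> 2 * u} \<le> D * measure Q {y \<in> space Q. U y \<le> u}"
    and D: "1 \<le> D" and s: "0 < s"
  shows "s\<^sup>2 * tmoment 2 s \<le> exp 1 * (\<Sum>k. doubling_series D k) * tmoment 0 s"
proof -
  let ?F = "\<lambda>u. measure Q {y \<in> space Q. U y \<le> u}"
  have "\<forall>\<^sub>F n in sequentially. s * B \<le> 2 ^ n"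
    by real_asymp
  \<comment> \<open>Since \<open>U\<close> is bounded, finitely many levels cover its range;
    \<open>n\<close> disappears once the partial sum is replaced by the full series.\<close>
  then obtain n where n: "s * B \<le> 2 ^ n"
    by (auto simp: eventually_sequentially)
  define g :: "nat \<Rightarrow> real" where "g k = 4 ^ k * exp (1 - 2 ^ k / 2)" for k
  have "s\<^sup>2 * tmoment 2 s = (\<integral>y. s\<^sup>2 * (U y ^ 2 * exp (- s * U y)) \<partial>Q)"
    unfolding tmoment_def by simp
  also have "\<dots> \<le> (\<integral>y. (\<Sum>k\<le>n. g k * indicator {y \<in> space Q. U y \<le> 2 ^ k * (1 / s)} y) \<partial>Q)"
  proof (rule integral_mono_AE)
    show "AE y in Q. s\<^sup>2 * (U y ^ 2 * exp (- s * U y)) \<le>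
        (\<Sum>k\<le>n. g k * indicator {y \<in> space Q. U y \<le> 2 ^ k * (1 / s)} y)"
      using U_bounds AE_space
    proof eventually_elim
      case (elim y)
      have "s * U y \<le> s * B" using elim s by simp
      then have "(s * U y)\<^sup>2 * exp (- (s * U y)) \<le>
          (\<Sum>k\<le>n. 4 ^ k * exp (1 - 2 ^ k / 2) * (if s * U y \<le> 2 ^ k then 1 else 0))"
        using n elim s by (intro dyadic_bound_square_exp mult_nonneg_nonneg) linarith+
      also have "\<dots> = (\<Sum>k\<le>n. g k * indicator {y \<in> space Q. U y \<le> 2 ^ k * (1 / s)} y)"
        using elim s by (intro sum.cong) (auto simp: g_def field_simps indicator_def)
      finally show ?case by (simp add: power_mult_distrib mult.assoc)
    qed
  qed (intro integrable_mult_right integrable_tmoment Bochner_Integration.integrable_sum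
        integrable_real_indicator measurable_sublevel | simp add: emeasure_eq_measure)+
  also have "\<dots> = (\<Sum>k\<le>n. g k * ?F (2 ^ k * (1 / s)))"
    by (subst Bochner_Integration.integral_sum)
       (auto intro!: integrable_real_indicator simp: emeasure_eq_measure)
  also have "\<dots> \<le> (\<Sum>k\<le>n. doubling_series D k * ?F (1 / s))"
  proof (rule sum_mono)
    fix k
    have "g k * ?F (2 ^ k * (1 / s)) \<le> g k * (D ^ k * ?F (1 / s))"
      using D s by (intro mult_left_mono measure_dyadic_le doubling) (auto simp: g_def)
    then show "g k * ?F (2 ^ k * (1 / s)) \<le> doubling_series D k * ?F (1 / s)"
      by (simp add: g_def doubling_series_def power_mult_distrib mult_ac)
  qed
  also have "\<dots> = (\<Sum>k\<le>n. doubling_series D k) * ?F (1 / s)"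
    by (simp add: sum_distrib_right)
  also have "\<dots> \<le> (\<Sum>k. doubling_series D k) * ?F (1 / s)"
    using D by (intro mult_right_mono sum_le_suminf summable_doubling_series)
      (auto simp: doubling_series_def)
  also have "\<dots> \<le> (\<Sum>k. doubling_series D k) * (exp 1 * tmoment 0 s)"
  proof (rule mult_left_mono)
    have "exp (- s * (1 / s)) * ?F (1 / s) \<le> tmoment 0 s"
      using s by (intro tmoment_0_ge) simp
    then show "?F (1 / s) \<le> exp 1 * tmoment 0 s"
      using s by (simp add: exp_minus field_simps)
    show "0 \<le> (\<Sum>k. doubling_series D k)"
      using D by (intro suminf_nonneg summable_doubling_series) (auto simp: doubling_series_def)
  qed
  finally show ?thesis by (simp add: mult_ac)
qed

section \<open>The tilted probability measure\<close>

definition tilted :: "real \<Rightarrow> 'a measure" where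
  "tilted s = density Q (\<lambda>y. ennreal (exp (- s * U y) / tmoment 0 s))"

lemma integral_tilted:
  assumes "0 \<le> s" and [measurable]: "f \<in> borel_measurable Q"
  shows "(\<integral>y. f y \<partial>tilted s) = (\<integral>y. f y * exp (- s * U y) \<partial>Q) / tmoment 0 s"
  unfolding tilted_def using tmoment_0_pos[OF assms(1)]
  by (subst integral_density) (simp_all add: mult.commute)

lemma prob_space_tilted:
  assumes "0 \<le> s"
  shows "prob_space (tilted s)"
proof
  have "emeasure (tilted s) (space (tilted s)) = (\<integral>\<^sup>+y. ennreal (exp (- s * U y) / tmoment 0 s) \<partial>Q)"
    unfolding tilted_def by (simp add: emeasure_density cong: nn_integral_cong)
  also have "\<dots> = ennreal (\<integral>y. U y ^ 0 * exp (- s * U y) / tmoment 0 s \<partial>Q)"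
    using integrable_tmoment[of 0 s] tmoment_0_pos[OF assms]
    by (subst nn_integral_eq_integral) simp_all
  also have "\<dots> = 1"
    using tmoment_0_pos[OF assms] unfolding integral_divide_zero tmoment_def[symmetric] by simp
  finally show "emeasure (tilted s) (space (tilted s)) = 1" .
qed

lemma AE_tilted: "AE y in Q. P y \<Longrightarrow> AE y in tilted s. P y"
  unfolding tilted_def by (subst AE_density) auto

lemma sets_tilted [measurable_cong, simp]: "sets (tilted s) = sets Q"
  by (simp add: tilted_def)

text \<open>Boundedness of \<open>U\<close> gives the integrability needed to expand the square. The
  last identity also shows that \<open>tvar s\<close> is nonnegative.\<close>

lemma tilted_mean_variance:
  assumes "0 \<le> s"
  shows "(\<integral>y. U y \<partial>tilted s) = tmean s"
    and "integrable (tilted s) (\<lambda>y. (U y - tmean s)\<^sup>2)"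
    and "(\<integral>y. (U y - tmean s)\<^sup>2 \<partial>tilted s) = tvar s"
proof -
  interpret T: prob_space "tilted s" by (rule prob_space_tilted) fact
  show mean: "(\<integral>y. U y \<partial>tilted s) = tmean s"
    using assms by (subst integral_tilted) (simp_all add: tmean_def tmoment_def)
  have U: "AE y in tilted s. 0 \<le> U y \<and> U y \<le> B"
    by (rule AE_tilted[OF U_bounds])
  have int1: "integrable (tilted s) U"
    by (rule T.integrable_const_bound[where B = B]) (use U in \<open>auto elim: eventually_mono\<close>)
  have int2: "integrable (tilted s) (\<lambda>y. (U y)\<^sup>2)"
    by (rule T.integrable_const_bound[where B = "B\<^sup>2"]) (use U in \<open>auto elim: eventually_mono intro!: power_mono\<close>)
  have eq: "(U y - tmean s)\<^sup>2 = (U y)\<^sup>2 - 2 * tmean s * U y + (tmean s)\<^sup>2" for y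
    by (simp add: power2_eq_square algebra_simps)
  show "integrable (tilted s) (\<lambda>y. (U y - tmean s)\<^sup>2)"
    unfolding eq using int1 int2 by simp
  have "(\<integral>y. (U y)\<^sup>2 \<partial>tilted s) = tmoment 2 s / tmoment 0 s"
    using assms by (subst integral_tilted) (simp_all add: tmoment_def)
  then show "(\<integral>y. (U y - tmean s)\<^sup>2 \<partial>tilted s) = tvar s"
    unfolding eq using int1 int2 mean
    by (simp add: T.prob_space tvar_def power2_eq_square)
qed

end

section \<open>Measures on Euclidean space with bounded support\<close>

lemma space_borel_Rn [simp]: "space (borel_Rn d) = Rn d"
  unfolding borel_Rn_def by (rule space_measure_of) (auto dest: openin_subset)

lemma openin_imp_sets_borel_Rn: "openin (Euclidean_space d) U \<Longrightarrow> U \<in> sets (borel_Rn d)"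
  unfolding borel_Rn_def by (subst sets_measure_of) (auto dest: openin_subset)

text \<open>Reduces questions about \<open>Euclidean_space d\<close> to the product topology on the
  function type, where the type-class notions of openness and continuity apply.\<close>

lemma openin_Euclidean_space_iff:
  "openin (Euclidean_space d) U \<longleftrightarrow> (\<exists>V. open V \<and> U = V \<inter> Rn d)"
  by (simp add: Euclidean_space_def openin_subtopology euclidean_product_topology)

lemma continuous_imp_borel_measurable_Rn:
  fixes f :: "(nat \<Rightarrow> real) \<Rightarrow> real"
  assumes "continuous_on UNIV f"
  shows "f \<in> borel_measurable (borel_Rn d)"
proof (rule borel_measurableI)
  fix S :: "real set" assume "open S"
  then have "open (f -` S)"
    using assms by (rule open_vimage)
  then show "f -` S \<inter> space (borel_Rn d) \<in> sets (borel_Rn d)"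
    by (auto intro!: openin_imp_sets_borel_Rn simp: openin_Euclidean_space_iff)
qed

lemma continuous_inner_Rn: "continuous_on UNIV (inner_Rn d x)"
  unfolding inner_Rn_def by (intro continuous_intros continuous_on_product_coordinates)

lemma norm_Rn_square: "(norm_Rn d y)\<^sup>2 = inner_Rn d y y"
  by (simp add: L2_set_def inner_Rn_def sum_nonneg flip: power2_eq_square)

lemma abs_inner_Rn_le: "\<bar>inner_Rn d x y\<bar> \<le> norm_Rn d x * norm_Rn d y"
proof -
  have "\<bar>inner_Rn d x y\<bar> \<le> (\<Sum>i<d. \<bar>x i\<bar> * \<bar>y i\<bar>)"
    unfolding inner_Rn_def by (rule order_trans[OF sum_abs]) (simp add: abs_mult)
  also have "\<dots> \<le> norm_Rn d x * norm_Rn d y"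
    by (rule L2_set_mult_ineq)
  finally show ?thesis .
qed

lemma inner_Rn_scale: "inner_Rn d (\<lambda>i. r * x i) y = r * inner_Rn d x y"
  by (simp add: inner_Rn_def sum_distrib_left mult.assoc)

lemma norm_Rn_scale: "0 \<le> r \<Longrightarrow> norm_Rn d (\<lambda>i. r * x i) = r * norm_Rn d x"
  by (simp add: L2_set_right_distrib)

lemma abs_coord_le_norm_Rn: "i < d \<Longrightarrow> \<bar>y i\<bar> \<le> norm_Rn d y"
  using member_le_L2_set[of "{..<d}" i "\<lambda>i. \<bar>y i\<bar>"] by (simp add: L2_set_def)

lemma UD_with_mono:
  assumes "UD_with d P D" "D \<le> D'"
  shows "UD_with d P D'"
  unfolding UD_with_def
proof (intro conjI ballI allI impI)
  fix \<theta> and u :: real assume "\<theta> \<in> sphere_Rn d" "0 < u"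
  then have "depth_cdf d P \<theta> (2 * u) \<le> D * depth_cdf d P \<theta> u"
    using assms(1) by (auto simp: UD_with_def)
  also have "\<dots> \<le> D' * depth_cdf d P \<theta> u"
    using assms(2) by (intro mult_right_mono) (auto simp: depth_cdf_def)
  finally show "depth_cdf d P \<theta> (2 * u) \<le> D' * depth_cdf d P \<theta> u" .
qed (use assms in \<open>auto simp: UD_with_def\<close>)

section \<open>Support and depth of a boundedly supported target\<close>

locale bounded_target =
  fixes d :: nat and P :: "(nat \<Rightarrow> real) measure" and R :: real
  assumes prob_Rn: "prob_Rn d P" and supp_bounded: "supp_Rn d P \<subseteq> cball_Rn d R"
begin

sublocale prob_space P
  using prob_Rn by (simp add: prob_Rn_def)

lemma sets_P [measurable_cong]: "sets P = sets (borel_Rn d)"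
  using prob_Rn by (simp add: prob_Rn_def)

lemma space_P: "space P = Rn d"
  using sets_eq_imp_space_eq[OF sets_P] by simp

lemma continuous_imp_borel_measurable_P:
  "continuous_on UNIV f \<Longrightarrow> f \<in> borel_measurable P" for f :: "(nat \<Rightarrow> real) \<Rightarrow> real"
  using continuous_imp_borel_measurable_Rn measurable_cong_sets[OF sets_P refl] by blast

lemma inner_Rn_measurable [measurable]: "inner_Rn d x \<in> borel_measurable P"
  by (intro continuous_imp_borel_measurable_P continuous_inner_Rn)

lemma coord_measurable [measurable]: "(\<lambda>y. y i) \<in> borel_measurable P"
  by (intro continuous_imp_borel_measurable_P continuous_on_product_coordinates)

lemma norm_Rn_measurable [measurable]: "(\<lambda>y. norm_Rn d y) \<in> borel_measurable P"
  unfolding L2_set_def by measurable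

lemma depth_measurable [measurable]: "depth d P \<theta> \<in> borel_measurable P"
  unfolding depth_def by measurable

text \<open>The complement of the support is a union of open null sets, hence null by the Lindelof property.\<close>

lemma AE_supp: "AE y in P. y \<in> supp_Rn d P"
proof -
  define \<F> where "\<F> = {V. open V \<and> measure P (V \<inter> Rn d) = 0}"
  obtain \<G> where \<G>: "\<G> \<subseteq> \<F>" "countable \<G>" "\<Union>\<G> = \<Union>\<F>"
    by (rule Lindelof[of \<F>]) (auto simp: \<F>_def)
  have "(\<Union>V\<in>\<G>. V \<inter> Rn d) \<in> null_sets P"
  proof (rule null_sets_UN')
    fix V assume "V \<in> \<G>"
    then have "open V" "measure P (V \<inter> Rn d) = 0" using \<G>(1) by (auto simp: \<F>_def)
    then show "V \<inter> Rn d \<in> null_sets P"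
      by (auto simp: null_sets_def emeasure_eq_measure sets_P openin_Euclidean_space_iff
          intro!: openin_imp_sets_borel_Rn)
  qed fact
  then show ?thesis
  proof (rule AE_I')
    show "{y \<in> space P. y \<notin> supp_Rn d P} \<subseteq> (\<Union>V\<in>\<G>. V \<inter> Rn d)"
    proof safe
      fix y assume y: "y \<in> space P" "y \<notin> supp_Rn d P"
      then obtain U where "openin (Euclidean_space d) U" "y \<in> U" "\<not> 0 < measure P U"
        by (auto simp: supp_Rn_def space_P)
      then obtain V where "V \<in> \<F>" "y \<in> V"
        by (auto simp: openin_Euclidean_space_iff \<F>_def zero_less_measure_iff)
      then show "y \<in> (\<Union>V\<in>\<G>. V \<inter> Rn d)"
        using \<G>(3) y space_P by auto
    qed
  qed
qed

lemma supp_nonempty: "supp_Rn d P \<noteq> {}"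
  using AE_supp by (metis AE_False emptyE eventually_mono)

lemma norm_supp_le: "y \<in> supp_Rn d P \<Longrightarrow> norm_Rn d y \<le> R"
  using supp_bounded by (auto simp: cball_Rn_def)

lemma norm_square_supp_le: "y \<in> supp_Rn d P \<Longrightarrow> (norm_Rn d y)\<^sup>2 \<le> R\<^sup>2"
  by (intro power_mono norm_supp_le) auto

lemma norm_square_le_SUP: "y \<in> supp_Rn d P \<Longrightarrow> (norm_Rn d y)\<^sup>2 \<le> (SUP y \<in> supp_Rn d P. (norm_Rn d y)\<^sup>2)"
  by (rule cSUP_upper) (auto intro!: bdd_aboveI[of _ "R\<^sup>2"] norm_square_supp_le)

lemma INF_le_norm_square: "y \<in> supp_Rn d P \<Longrightarrow> (INF y \<in> supp_Rn d P. (norm_Rn d y)\<^sup>2) \<le> (norm_Rn d y)\<^sup>2"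
  by (rule cINF_lower) (auto intro!: bdd_belowI[of _ 0])

lemma norm_gap_bounds: "0 \<le> norm_gap d P" "norm_gap d P \<le> R\<^sup>2"
proof -
  obtain y where "y \<in> supp_Rn d P" using supp_nonempty by auto
  then show "0 \<le> norm_gap d P"
    unfolding norm_gap_def using norm_square_le_SUP INF_le_norm_square by force
  have "(SUP y \<in> supp_Rn d P. (norm_Rn d y)\<^sup>2) \<le> R\<^sup>2"
    by (rule cSUP_least[OF supp_nonempty norm_square_supp_le])
  moreover have "0 \<le> (INF y \<in> supp_Rn d P. (norm_Rn d y)\<^sup>2)"
    by (rule cINF_greatest[OF supp_nonempty]) simp
  ultimately show "norm_gap d P \<le> R\<^sup>2"
    by (simp add: norm_gap_def)
qed

lemma inner_supp_bounds:
  assumes "\<theta> \<in> sphere_Rn d" "y \<in> supp_Rn d P"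
  shows "\<bar>inner_Rn d \<theta> y\<bar> \<le> R"
  using abs_inner_Rn_le[of d \<theta> y] norm_supp_le[OF assms(2)] assms(1)
  by (simp add: sphere_Rn_def)

lemma bdd_above_inner_supp:
  "\<theta> \<in> sphere_Rn d \<Longrightarrow> bdd_above (inner_Rn d \<theta> ` supp_Rn d P)"
  using inner_supp_bounds by (intro bdd_aboveI[of _ R]) force

lemma depth_supp_bounds:
  assumes "\<theta> \<in> sphere_Rn d" "y \<in> supp_Rn d P"
  shows "0 \<le> depth d P \<theta> y \<and> depth d P \<theta> y \<le> 2 * R"
proof
  show "0 \<le> depth d P \<theta> y"
    unfolding depth_def using cSUP_upper[OF assms(2) bdd_above_inner_supp[OF assms(1)]] by simp
  have "(SUP y' \<in> supp_Rn d P. inner_Rn d \<theta> y') \<le> R"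
    using inner_supp_bounds[OF assms(1)] by (intro cSUP_least supp_nonempty) force
  then show "depth d P \<theta> y \<le> 2 * R"
    unfolding depth_def using inner_supp_bounds[OF assms] by linarith
qed

text \<open>Some point of the support comes within \<open>u\<close> of the supremum defining the
  depth. An open half-space around that point has positive mass by the definition of the support,
  and its points have depth below \<open>u\<close>.\<close>

lemma depth_cdf_pos:
  assumes "\<theta> \<in> sphere_Rn d" "0 < u"
  shows "0 < depth_cdf d P \<theta> u"
proof -
  let ?h = "SUP y' \<in> supp_Rn d P. inner_Rn d \<theta> y'"
  obtain y where y: "y \<in> supp_Rn d P" "?h - u < inner_Rn d \<theta> y"
    using less_cSUP_iff[OF supp_nonempty bdd_above_inner_supp[OF assms(1)], of "?h - u"] assms(2)
    by auto
  let ?V = "{y. ?h - u < inner_Rn d \<theta> y}"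
  have "open ?V"
    by (intro open_Collect_less continuous_on_const continuous_inner_Rn)
  then have "0 < measure P (?V \<inter> Rn d)"
    using y by (auto simp: supp_Rn_def openin_Euclidean_space_iff)
  also have "\<dots> \<le> depth_cdf d P \<theta> u"
    unfolding depth_cdf_def
  proof (rule finite_measure_mono)
    show "?V \<inter> Rn d \<subseteq> {y \<in> space P. depth d P \<theta> y \<le> u}"
      by (auto simp: depth_def space_P)
  qed measurable
  finally show ?thesis .
qed

section \<open>Reweighting by the Gaussian factor that does not involve \<open>x\<close>\<close>

definition gauss_weighted :: "real \<Rightarrow> (nat \<Rightarrow> real) measure" where
  "gauss_weighted c = density P (\<lambda>y. ennreal (exp (- c * (norm_Rn d y)\<^sup>2)))"

lemma sets_gauss_weighted [measurable_cong, simp]: "sets (gauss_weighted c) = sets P"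
  by (simp add: gauss_weighted_def)

lemma space_gauss_weighted [simp]: "space (gauss_weighted c) = space P"
  by (simp add: gauss_weighted_def)

lemma integrable_gauss:
  assumes "0 \<le> c" "E \<in> sets P"
  shows "integrable P (\<lambda>y. exp (- c * (norm_Rn d y)\<^sup>2) * indicator E y)"
  using assms by (intro integrable_const_bound[where B = 1]) (auto simp: indicator_def)

lemma emeasure_gauss_weighted:
  assumes "0 \<le> c" "E \<in> sets P"
  shows "emeasure (gauss_weighted c) E =
    ennreal (\<integral>y. exp (- c * (norm_Rn d y)\<^sup>2) * indicator E y \<partial>P)"
proof -
  have "emeasure (gauss_weighted c) E = (\<integral>\<^sup>+y. ennreal (exp (- c * (norm_Rn d y)\<^sup>2) * indicator E y) \<partial>P)"
    unfolding gauss_weighted_def using assms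
    by (subst emeasure_density) (auto intro!: nn_integral_cong simp: indicator_def)
  also have "\<dots> = ennreal (\<integral>y. exp (- c * (norm_Rn d y)\<^sup>2) * indicator E y \<partial>P)"
    by (rule nn_integral_eq_integral[OF integrable_gauss[OF assms]]) simp
  finally show ?thesis .
qed

lemma finite_measure_gauss_weighted: "0 \<le> c \<Longrightarrow> finite_measure (gauss_weighted c)"
  by (rule finite_measureI) (simp add: emeasure_gauss_weighted)

text \<open>Almost every point lies in the support, where the squared norm stays between its infimum
  and supremum, so the density is pinched between two constants whose ratio is
  \<open>exp (c * norm_gap d P)\<close>.\<close>

lemma measure_gauss_weighted_bounds:
  assumes "0 \<le> c" "E \<in> sets P"
  shows "exp (- c * (SUP y \<in> supp_Rn d P. (norm_Rn d y)\<^sup>2)) * measure P E \<le> measure (gauss_weighted c) E"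
    and "measure (gauss_weighted c) E \<le> exp (- c * (INF y \<in> supp_Rn d P. (norm_Rn d y)\<^sup>2)) * measure P E"
proof -
  have eq: "measure (gauss_weighted c) E = (\<integral>y. exp (- c * (norm_Rn d y)\<^sup>2) * indicator E y \<partial>P)"
    unfolding measure_def emeasure_gauss_weighted[OF assms]
    by (simp add: integral_nonneg_AE)
  have const: "(\<integral>y. k * indicator E y \<partial>P) = k * measure P E" "integrable P (\<lambda>y. k * indicator E y)" for k :: real
    using assms(2) by (auto simp: emeasure_eq_measure)
  show "exp (- c * (SUP y \<in> supp_Rn d P. (norm_Rn d y)\<^sup>2)) * measure P E \<le> measure (gauss_weighted c) E"
    unfolding eq const(1)[symmetric]
  proof (rule integral_mono_AE)
    show "AE y in P. exp (- c * (SUP y \<in> supp_Rn d P. (norm_Rn d y)\<^sup>2)) * indicator E y \<le> exp (- c * (norm_Rn d y)\<^sup>2) * indicator E y"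
      using AE_supp
      by eventually_elim (use assms(1) norm_square_le_SUP in \<open>auto simp: indicator_def mult_left_mono\<close>)
  qed (use const integrable_gauss[OF assms] in auto)
  show "measure (gauss_weighted c) E \<le> exp (- c * (INF y \<in> supp_Rn d P. (norm_Rn d y)\<^sup>2)) * measure P E"
    unfolding eq const(1)[symmetric]
  proof (rule integral_mono_AE)
    show "AE y in P. exp (- c * (norm_Rn d y)\<^sup>2) * indicator E y \<le> exp (- c * (INF y \<in> supp_Rn d P. (norm_Rn d y)\<^sup>2)) * indicator E y"
      using AE_supp
      by eventually_elim (use assms(1) INF_le_norm_square in \<open>auto simp: indicator_def mult_left_mono\<close>)
  qed (use const integrable_gauss[OF assms] in auto)
qed

text \<open>Mass near depth zero survives the reweighting because the density is bounded below on
  the support.\<close>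

lemma exponential_tilt_depth:
  assumes "0 \<le> c" "\<theta> \<in> sphere_Rn d"
  shows "exponential_tilt (gauss_weighted c) (depth d P \<theta>) (2 * R)"
proof -
  interpret finite_measure "gauss_weighted c"
    by (rule finite_measure_gauss_weighted) fact
  show ?thesis
  proof
    show "AE y in gauss_weighted c. 0 \<le> depth d P \<theta> y \<and> depth d P \<theta> y \<le> 2 * R"
      unfolding gauss_weighted_def using AE_supp
      by (subst AE_density) (auto elim!: eventually_mono dest: depth_supp_bounds[OF assms(2)])
    fix u :: real assume "0 < u"
    then have "0 < exp (- c * (SUP y \<in> supp_Rn d P. (norm_Rn d y)\<^sup>2)) * depth_cdf d P \<theta> u"
      using depth_cdf_pos[OF assms(2)] by simp
    also have "\<dots> \<le> measure (gauss_weighted c) {y \<in> space P. depth d P \<theta> y \<le> u}"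
      unfolding depth_cdf_def by (rule measure_gauss_weighted_bounds) (use assms in measurable)
    finally show "0 < measure (gauss_weighted c) {y \<in> space (gauss_weighted c). depth d P \<theta> y \<le> u}"
      by simp
  qed measurable
qed

text \<open>The lower density bound is used on \<open>A'\<close> and the upper one on
  \<open>A\<close>; their ratio is the loss in the constant.\<close>

lemma doubling_gauss_weighted_imp_doubling:
  assumes "0 \<le> c" "0 \<le> D" and [measurable]: "A \<in> sets P" "A' \<in> sets P"
    and "measure (gauss_weighted c) A' \<le> D * measure (gauss_weighted c) A"
  shows "measure P A' \<le> D * exp (c * norm_gap d P) * measure P A"
proof -
  let ?S = "SUP y \<in> supp_Rn d P. (norm_Rn d y)\<^sup>2" and ?I = "INF y \<in> supp_Rn d P. (norm_Rn d y)\<^sup>2"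
  have "exp (- c * ?S) * measure P A' \<le> D * (exp (- c * ?I) * measure P A)"
    using measure_gauss_weighted_bounds(1)[OF assms(1,4)] assms(5)
      mult_left_mono[OF measure_gauss_weighted_bounds(2)[OF assms(1,3)] \<open>0 \<le> D\<close>] by linarith
  then have *: "exp (c * ?S) * (exp (- c * ?S) * measure P A') \<le> exp (c * ?S) * (D * (exp (- c * ?I) * measure P A))"
    by (rule mult_left_mono) simp
  have "measure P A' = exp (c * ?S) * (exp (- c * ?S) * measure P A')"
    by (simp add: exp_minus)
  also note *
  also have "exp (c * ?S) * (D * (exp (- c * ?I) * measure P A)) =
      D * (exp (c * ?S) * exp (- c * ?I)) * measure P A"
    by (simp only: mult_ac)
  also have "exp (c * ?S) * exp (- c * ?I) = exp (c * norm_gap d P)"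
    by (simp add: norm_gap_def right_diff_distrib flip: exp_add)
  finally show ?thesis .
qed

text \<open>The mirror image: upper density bound on \<open>A'\<close>, lower one on
  \<open>A\<close>, with the same loss.\<close>

lemma doubling_imp_doubling_gauss_weighted:
  assumes "0 \<le> c" "0 \<le> D" and [measurable]: "A \<in> sets P" "A' \<in> sets P"
    and "measure P A' \<le> D * measure P A"
  shows "measure (gauss_weighted c) A' \<le> D * exp (c * norm_gap d P) * measure (gauss_weighted c) A"
proof -
  let ?S = "SUP y \<in> supp_Rn d P. (norm_Rn d y)\<^sup>2" and ?I = "INF y \<in> supp_Rn d P. (norm_Rn d y)\<^sup>2"
  have eq: "exp (- c * ?I) = exp (c * norm_gap d P) * exp (- c * ?S)"
    by (simp add: norm_gap_def right_diff_distrib flip: exp_add)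
  have "measure (gauss_weighted c) A' \<le> exp (- c * ?I) * measure P A'"
    by (rule measure_gauss_weighted_bounds(2)[OF assms(1,4)])
  also have "\<dots> \<le> exp (- c * ?I) * (D * measure P A)"
    using assms(5) by (rule mult_left_mono) simp
  also have "\<dots> = D * exp (c * norm_gap d P) * (exp (- c * ?S) * measure P A)"
    unfolding eq by simp
  also have "\<dots> \<le> D * exp (c * norm_gap d P) * measure (gauss_weighted c) A"
    by (intro mult_left_mono measure_gauss_weighted_bounds(1)[OF assms(1,3)]) (use \<open>0 \<le> D\<close> in simp)
  finally show ?thesis .
qed

end

section \<open>The posterior as an exponential tilt\<close>

lemma norm_Rn_diff_scale_square:
  "(norm_Rn d (\<lambda>i. x i - a * y i))\<^sup>2 = (norm_Rn d x)\<^sup>2 - 2 * a * inner_Rn d x y + a\<^sup>2 * (norm_Rn d y)\<^sup>2"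
  unfolding norm_Rn_square inner_Rn_def
  by (simp add: algebra_simps power2_eq_square sum.distrib sum_subtractf sum_distrib_left)

text \<open>Expanding the square leaves a factor in \<open>x\<close> only, a linear exponent and a
  factor in \<open>y\<close> only. With \<open>a = exp (- t / 2)\<close> the coefficients are
  \<open>a / (1 - a ^ 2)\<close> and \<open>a ^ 2 / (2 * (1 - a ^ 2))\<close>, so the claim becomes
  a rational identity in \<open>a\<close>.\<close>

lemma post_weight_factorization:
  assumes "0 < t"
  shows "post_weight d t x y =
    exp (- (norm_Rn d x)\<^sup>2 / (2 * (1 - exp (- t)))) *
    exp (exp (t / 2) / (exp t - 1) * inner_Rn d x y) * exp (- (1 / (2 * (exp t - 1))) * (norm_Rn d y)\<^sup>2)"
proof -
  define a where "a = exp (- t / 2)"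
  have a: "0 < a" "a < 1" using assms by (auto simp: a_def)
  then have "a * a < 1" using mult_strict_mono[of a 1 a 1] by simp
  have eqs: "exp (- t) = a\<^sup>2" "exp t = inverse (a\<^sup>2)" "exp (t / 2) = inverse a"
    by (simp_all add: a_def power2_eq_square flip: exp_add exp_minus)
  have "- (norm_Rn d x)\<^sup>2 / (2 * (1 - exp (- t))) + exp (t / 2) / (exp t - 1) * inner_Rn d x y
      + - (1 / (2 * (exp t - 1))) * (norm_Rn d y)\<^sup>2
    = - (norm_Rn d (\<lambda>i. x i - exp (- t / 2) * y i))\<^sup>2 / (2 * (1 - exp (- t)))"
    unfolding a_def[symmetric] norm_Rn_diff_scale_square eqs
    using a \<open>a * a < 1\<close> by (simp add: divide_simps power2_eq_square) (simp add: algebra_simps)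
  then show ?thesis
    unfolding post_weight_def by (simp flip: exp_add)
qed

context bounded_target
begin

text \<open>The inner product with \<open>\<theta>\<close> is its supremum over the support minus
  the depth, so the linear exponent becomes \<open>- s\<close> times the depth plus a constant. That
  constant and the factor in \<open>x\<close> only are collected in \<open>\<kappa>\<close>, which
  cancels in the normalisation.\<close>

lemma posterior_eq_tilted:
  fixes t r :: real and \<theta> :: "nat \<Rightarrow> real"
  assumes t: "0 < t" and \<theta>: "\<theta> \<in> sphere_Rn d" and r: "0 \<le> r"
  defines "c \<equiv> 1 / (2 * (exp t - 1))" and "s \<equiv> exp (t / 2) / (exp t - 1) * r"
  shows "posterior d P (\<lambda>i. r * \<theta> i) t =
    exponential_tilt.tilted (gauss_weighted c) (depth d P \<theta>) s"
proof -
  have "0 \<le> c" "0 \<le> s" using t r by (auto simp: c_def s_def)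
  interpret T: exponential_tilt "gauss_weighted c" "depth d P \<theta>" "2 * R"
    by (rule exponential_tilt_depth) fact+
  let ?x = "\<lambda>i. r * \<theta> i"
  let ?w = "\<lambda>y. exp (- c * (norm_Rn d y)\<^sup>2)" and ?e = "\<lambda>y. exp (- s * depth d P \<theta> y)"
  define \<kappa> where "\<kappa> = exp (- (norm_Rn d ?x)\<^sup>2 / (2 * (1 - exp (- t)))) *
    exp (s * (SUP y' \<in> supp_Rn d P. inner_Rn d \<theta> y'))"
  have "0 < \<kappa>" by (simp add: \<kappa>_def)
  define l where "l = exp (t / 2) / (exp t - 1)"
  have s: "s = l * r" by (simp add: s_def l_def)
  have weight: "post_weight d t ?x y = \<kappa> * (?w y * ?e y)" for y
    unfolding post_weight_factorization[OF t] \<kappa>_def inner_Rn_scale depth_def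
      c_def[symmetric] l_def[symmetric] s
    by (simp add: algebra_simps flip: exp_add)
  define Z where "Z = T.tmoment 0 s"
  have "0 < Z" unfolding Z_def by (rule T.tmoment_0_pos) fact
  have "(\<integral>\<^sup>+y. ennreal (?w y * ?e y) \<partial>P) = (\<integral>\<^sup>+y. ennreal (?e y) \<partial>gauss_weighted c)"
    unfolding gauss_weighted_def by (subst nn_integral_density) (auto simp: ennreal_mult)
  also have "\<dots> = ennreal (\<integral>y. ?e y \<partial>gauss_weighted c)"
    using T.integrable_tmoment[of 0 s] by (intro nn_integral_eq_integral) auto
  also have "\<dots> = ennreal Z"
    by (simp add: Z_def T.tmoment_def)
  finally have "(\<integral>\<^sup>+y. ennreal (post_weight d t ?x y) \<partial>P) = ennreal (\<kappa> * Z)"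
    unfolding weight using \<open>0 < \<kappa>\<close> by (simp add: ennreal_mult' nn_integral_cmult)
  then have "posterior d P ?x t = density P (\<lambda>y. ennreal (\<kappa> * (?w y * ?e y)) / ennreal (\<kappa> * Z))"
    unfolding posterior_def by (simp add: weight)
  also have "\<dots> = density P (\<lambda>y. ennreal (?w y) * ennreal (?e y / Z))"
    using \<open>0 < \<kappa>\<close> \<open>0 < Z\<close>
    by (intro arg_cong[where f = "density P"] ext) (simp add: divide_ennreal flip: ennreal_mult')
  also have "\<dots> = density (gauss_weighted c) (\<lambda>y. ennreal (?e y / Z))"
    unfolding gauss_weighted_def by (subst density_density_eq) auto
  finally show ?thesis
    by (simp add: T.tilted_def Z_def)
qed

text \<open>The centred inner product is \<open>- r\<close> times the centred depth, so its second
  moment is \<open>r ^ 2\<close> times the tilted variance. This is finite, so the infinite branch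
  of \<open>L2_norm\<close> does not arise.\<close>

lemma L2_norm_posterior:
  fixes t r :: real and \<theta> :: "nat \<Rightarrow> real"
  assumes t: "0 < t" and \<theta>: "\<theta> \<in> sphere_Rn d" and r: "0 \<le> r"
  defines "c \<equiv> 1 / (2 * (exp t - 1))" and "s \<equiv> exp (t / 2) / (exp t - 1) * r"
  defines "x \<equiv> \<lambda>i. r * \<theta> i"
  shows "L2_norm (posterior d P x t) (\<lambda>y. inner_Rn d x (\<lambda>i. y i - post_mean d P x t i)) =
    ennreal (sqrt (r\<^sup>2 * exponential_tilt.tvar (gauss_weighted c) (depth d P \<theta>) s))"
proof -
  have "0 \<le> c" "0 \<le> s" using t r by (auto simp: c_def s_def)
  interpret T: exponential_tilt "gauss_weighted c" "depth d P \<theta>" "2 * R"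
    by (rule exponential_tilt_depth) fact+
  let ?N = "T.tilted s" and ?h = "SUP y' \<in> supp_Rn d P. inner_Rn d \<theta> y'"
  have N: "posterior d P x t = ?N"
    unfolding c_def s_def x_def by (rule posterior_eq_tilted) fact+
  interpret N: prob_space ?N by (rule T.prob_space_tilted) fact
  have "AE y in gauss_weighted c. y \<in> supp_Rn d P"
    unfolding gauss_weighted_def using AE_supp by (subst AE_density) auto
  then have supp: "AE y in ?N. y \<in> supp_Rn d P"
    by (rule T.AE_tilted)
  have int: "integrable ?N (\<lambda>y. y i)" if "i < d" for i
    using supp abs_coord_le_norm_Rn[OF that] norm_supp_le
    by (intro N.integrable_const_bound[where B = R])
       (auto elim!: eventually_mono intro: order_trans)
  have U: "AE y in ?N. 0 \<le> depth d P \<theta> y \<and> depth d P \<theta> y \<le> 2 * R"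
    by (rule T.AE_tilted[OF T.U_bounds])
  have intU: "integrable ?N (depth d P \<theta>)"
    by (rule N.integrable_const_bound[where B = "2 * R"]) (use U in \<open>auto elim: eventually_mono\<close>)
  \<comment> \<open>The mean is defined coordinatewise, so the finite sum is exchanged with the
    integral; this uses integrability of each coordinate.\<close>
  have "inner_Rn d \<theta> (post_mean d P x t) = (\<integral>y. inner_Rn d \<theta> y \<partial>?N)"
    unfolding post_mean_def N inner_Rn_def using int by (subst Bochner_Integration.integral_sum) auto
  also have "\<dots> = (\<integral>y. ?h - depth d P \<theta> y \<partial>?N)"
    by (simp add: depth_def)
  also have "\<dots> = ?h - T.tmean s"
    using intU T.tilted_mean_variance(1)[OF \<open>0 \<le> s\<close>] by (simp add: N.prob_space)
  finally have mean: "inner_Rn d \<theta> (post_mean d P x t) = ?h - T.tmean s" .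
  have f: "(inner_Rn d x (\<lambda>i. y i - post_mean d P x t i))\<^sup>2 = r\<^sup>2 * (depth d P \<theta> y - T.tmean s)\<^sup>2" for y
  proof -
    have "inner_Rn d x (\<lambda>i. y i - post_mean d P x t i) =
        r * (inner_Rn d \<theta> y - inner_Rn d \<theta> (post_mean d P x t))"
      unfolding x_def inner_Rn_scale by (simp add: inner_Rn_def algebra_simps sum_subtractf)
    also have "\<dots> = - (r * (depth d P \<theta> y - T.tmean s))"
      unfolding mean by (simp add: depth_def algebra_simps)
    finally show ?thesis by (simp add: power_mult_distrib)
  qed
  have "(\<integral>\<^sup>+y. ennreal ((inner_Rn d x (\<lambda>i. y i - post_mean d P x t i))\<^sup>2) \<partial>?N) =
      ennreal (\<integral>y. r\<^sup>2 * (depth d P \<theta> y - T.tmean s)\<^sup>2 \<partial>?N)"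
    unfolding f using T.tilted_mean_variance(2)[OF \<open>0 \<le> s\<close>]
    by (intro nn_integral_eq_integral) auto
  moreover have "(\<integral>y. r\<^sup>2 * (depth d P \<theta> y - T.tmean s)\<^sup>2 \<partial>?N) = r\<^sup>2 * T.tvar s"
    using T.tilted_mean_variance(3)[OF \<open>0 \<le> s\<close>] by simp
  moreover have "0 \<le> T.tvar s"
    unfolding T.tilted_mean_variance(3)[OF \<open>0 \<le> s\<close>, symmetric] by simp
  ultimately show ?thesis
    unfolding L2_norm_def N by simp
qed

section \<open>The two implications with explicit constants\<close>

lemma fluct_const_finite_imp_UD_with:
  assumes t: "0 < t" and C: "fluct_const d P t < \<infinity>"
  shows "UD_with d P (2 * exp (4 * exp t * (enn2real (fluct_const d P t))\<^sup>2 / (exp t - 1)\<^sup>2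
    + norm_gap d P / (2 * (exp t - 1))))"
proof -
  define c where "c = 1 / (2 * (exp t - 1))"
  define l where "l = exp (t / 2) / (exp t - 1)"
  \<comment> \<open>As \<open>s = l * r\<close>, a bound on \<open>r ^ 2\<close> times the variance
    is multiplied by \<open>l ^ 2 = exp t / (exp t - 1) ^ 2\<close>; hence
    \<open>exp (4 * K)\<close> is the first exponential factor of the claimed constant.\<close>
  define K where "K = l\<^sup>2 * (enn2real (fluct_const d P t))\<^sup>2"
  have "0 \<le> c" "0 < l" using t by (auto simp: c_def l_def)
  have "0 \<le> K" by (simp add: K_def)
  have const: "2 * exp (4 * exp t * (enn2real (fluct_const d P t))\<^sup>2 / (exp t - 1)\<^sup>2
    + norm_gap d P / (2 * (exp t - 1))) = 2 * exp (4 * K) * exp (c * norm_gap d P)"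
    by (simp add: K_def l_def c_def power_divide exp_add flip: exp_double)
  show ?thesis
    unfolding const UD_with_def
  proof (intro conjI ballI allI impI)
    have "1 \<le> exp (4 * K)" "1 \<le> exp (c * norm_gap d P)"
      using \<open>0 \<le> K\<close> \<open>0 \<le> c\<close> norm_gap_bounds by simp_all
    then have "1 * 1 \<le> exp (4 * K) * exp (c * norm_gap d P)" by (intro mult_mono) auto
    then show "1 \<le> 2 * exp (4 * K) * exp (c * norm_gap d P)" by simp
  next
    fix \<theta> and u :: real assume \<theta>: "\<theta> \<in> sphere_Rn d" and "0 < u"
    interpret T: exponential_tilt "gauss_weighted c" "depth d P \<theta>" "2 * R"
      by (rule exponential_tilt_depth) fact+
    have var: "s\<^sup>2 * T.tvar s \<le> K" if "0 < s" for s
    proof -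
      \<comment> \<open>Every tilt \<open>s > 0\<close> is realised by a posterior, namely at the
        point of norm \<open>s / l\<close> in direction \<open>\<theta>\<close>.\<close>
      define r where "r = s / l"
      have "0 \<le> r" "s = l * r" using that \<open>0 < l\<close> by (auto simp: r_def)
      have "(\<lambda>i. r * \<theta> i) \<in> Rn d"
        using \<theta> by (auto simp: sphere_Rn_def topspace_Euclidean_space)
      then have "ennreal (sqrt (r\<^sup>2 * T.tvar s)) \<le> fluct_const d P t"
        unfolding fluct_const_def \<open>s = l * r\<close> c_def l_def
          L2_norm_posterior[OF t \<theta> \<open>0 \<le> r\<close>, symmetric]
        by (rule SUP_upper)
      also have "\<dots> = ennreal (enn2real (fluct_const d P t))"
        using C by simp
      finally have "sqrt (r\<^sup>2 * T.tvar s) \<le> enn2real (fluct_const d P t)"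
        by (simp add: ennreal_le_iff)
      then have "r\<^sup>2 * T.tvar s \<le> (enn2real (fluct_const d P t))\<^sup>2"
        by (rule sqrt_le_D)
      then have "l\<^sup>2 * (r\<^sup>2 * T.tvar s) \<le> K"
        unfolding K_def by (rule mult_left_mono) simp
      then show ?thesis
        by (simp add: \<open>s = l * r\<close> power_mult_distrib mult.assoc)
    qed
    show "depth_cdf d P \<theta> (2 * u) \<le> 2 * exp (4 * K) * exp (c * norm_gap d P) * depth_cdf d P \<theta> u"
      unfolding depth_cdf_def
      using T.doubling_of_tvar_le[OF var \<open>0 < u\<close>] \<open>0 \<le> c\<close>
      by (intro doubling_gauss_weighted_imp_doubling) auto
  qed
qed

text \<open>The bound involves only \<open>D\<close>, \<open>R\<close> and \<open>t\<close>, with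
  \<open>norm_gap\<close> replaced by its bound \<open>R ^ 2\<close>, so it is the same for all
  dimensions and targets sharing these data.\<close>

lemma UD_with_imp_fluct_const_le:
  assumes t: "0 < t" and D: "UD_with d P D"
  shows "fluct_const d P t \<le> ennreal (sqrt (exp 1 *
    (\<Sum>k. doubling_series (D * exp (R\<^sup>2 / (2 * (exp t - 1)))) k) * ((exp t - 1)\<^sup>2 / exp t)))"
  unfolding fluct_const_def
proof (rule SUP_least)
  fix x assume x: "x \<in> Rn d"
  define c where "c = 1 / (2 * (exp t - 1))"
  define l where "l = exp (t / 2) / (exp t - 1)"
  define D' where "D' = D * exp (R\<^sup>2 / (2 * (exp t - 1)))"
  define S where "S = exp 1 * (\<Sum>k. doubling_series D' k)"
  have "0 \<le> c" "0 < l" using t by (auto simp: c_def l_def)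
  have l: "(exp t - 1)\<^sup>2 / exp t = 1 / l\<^sup>2"
    by (simp add: l_def power_divide flip: exp_double)
  have "1 \<le> D" using D by (simp add: UD_with_def)
  have "1 * 1 \<le> D'"
    unfolding D'_def using \<open>1 \<le> D\<close> t by (intro mult_mono) auto
  then have "1 \<le> D'" by simp
  have DD': "D * exp (c * norm_gap d P) \<le> D'"
    unfolding D'_def c_def using \<open>1 \<le> D\<close> norm_gap_bounds(2) t by (simp add: divide_right_mono)
  have "L2_norm (posterior d P x t) (\<lambda>y. inner_Rn d x (\<lambda>i. y i - post_mean d P x t i))
      \<le> ennreal (sqrt (S / l\<^sup>2))"
  proof (cases "norm_Rn d x = 0")
    \<comment> \<open>There is no direction to normalise, but the fluctuation vanishes by the
      Cauchy-Schwarz inequality.\<close>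
    case True
    then have "inner_Rn d x (\<lambda>i. y i - post_mean d P x t i) = 0" for y
      using abs_inner_Rn_le[of d x] by (metis abs_le_zero_iff mult_zero_left)
    then show ?thesis by (simp add: L2_norm_def)
  next
    case False
    define r where "r = norm_Rn d x"
    define \<theta> where "\<theta> = (\<lambda>i. inverse r * x i)"
    have "0 < r" using False L2_set_nonneg[of x "{..<d}"] unfolding r_def by linarith
    then have "norm_Rn d \<theta> = 1"
      unfolding \<theta>_def by (subst norm_Rn_scale) (auto simp: r_def)
    then have \<theta>: "\<theta> \<in> sphere_Rn d"
      using x by (auto simp: sphere_Rn_def topspace_Euclidean_space \<theta>_def)
    have x_eq: "x = (\<lambda>i. r * \<theta> i)" using \<open>0 < r\<close> by (auto simp: \<theta>_def)
    interpret T: exponential_tilt "gauss_weighted c" "depth d P \<theta>" "2 * R"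
      by (rule exponential_tilt_depth) fact+
    define s where "s = l * r"
    have "0 < s" using \<open>0 < l\<close> \<open>0 < r\<close> by (simp add: s_def)
    have doubling: "measure (gauss_weighted c) {y \<in> space (gauss_weighted c). depth d P \<theta> y \<le> 2 * u}
        \<le> D' * measure (gauss_weighted c) {y \<in> space (gauss_weighted c). depth d P \<theta> y \<le> u}"
      (is "?L \<le> D' * ?M") if "0 < u" for u
    proof -
      have "?L \<le> D * exp (c * norm_gap d P) * ?M"
        using D \<theta> that \<open>1 \<le> D\<close> \<open>0 \<le> c\<close>
        by (intro doubling_imp_doubling_gauss_weighted) (auto simp: UD_with_def depth_cdf_def)
      also have "\<dots> \<le> D' * ?M" using DD' by (intro mult_right_mono) auto
      finally show ?thesis .
    qed
    have "s\<^sup>2 * T.tmoment 2 s \<le> S * T.tmoment 0 s"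
      unfolding S_def by (rule T.tmoment_2_le_of_doubling) fact+
    then have "s\<^sup>2 * (T.tmoment 2 s / T.tmoment 0 s) \<le> S"
      using T.tmoment_0_pos[of s] \<open>0 < s\<close> by (simp add: field_simps)
    \<comment> \<open>The variance is at most the second moment about zero.\<close>
    moreover have "s\<^sup>2 * T.tvar s \<le> s\<^sup>2 * (T.tmoment 2 s / T.tmoment 0 s)"
      unfolding T.tvar_def by (intro mult_left_mono) auto
    ultimately have "l\<^sup>2 * (r\<^sup>2 * T.tvar s) \<le> S"
      by (simp add: s_def power_mult_distrib mult.assoc)
    then have "r\<^sup>2 * T.tvar s \<le> S / l\<^sup>2"
      using \<open>0 < l\<close> by (simp add: field_simps)
    then show ?thesis
      unfolding L2_norm_posterior[OF t \<theta> less_imp_le[OF \<open>0 < r\<close>], folded c_def l_def, folded s_def x_eq]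
      by (intro ennreal_leI real_sqrt_le_mono)
  qed
  then show "L2_norm (posterior d P x t) (\<lambda>y. inner_Rn d x (\<lambda>i. y i - post_mean d P x t i))
      \<le> ennreal (sqrt (exp 1 * (\<Sum>k. doubling_series (D * exp (R\<^sup>2 / (2 * (exp t - 1)))) k) *
          ((exp t - 1)\<^sup>2 / exp t)))"
    unfolding l by (simp add: S_def D'_def)
qed

end

section \<open>Compact supports and families of targets\<close>

lemma compactin_imp_subset_cball_Rn:
  assumes "compactin (Euclidean_space d) S"
  obtains R where "S \<subseteq> cball_Rn d R"
proof -
  have "compact S"
    using assms by (simp add: Euclidean_space_def compactin_subtopology euclidean_product_topology)
  moreover have "continuous_on S (\<lambda>y. norm_Rn d y)"
    unfolding L2_set_def
    by (intro continuous_intros continuous_on_subset[OF continuous_on_product_coordinates]) auto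
  ultimately have "bounded ((\<lambda>y. norm_Rn d y) ` S)"
    by (intro compact_imp_bounded compact_continuous_image)
  then obtain R where "\<forall>y\<in>S. norm_Rn d y \<le> R"
    by (auto simp: bounded_iff)
  then have "S \<subseteq> cball_Rn d R"
    using compactin_subset_topspace[OF assms] by (auto simp: cball_Rn_def)
  then show thesis by (rule that)
qed

theorem corollary3p4:
  fixes t :: real
  assumes "0 < t"
  shows
    "(\<forall>(d::nat) P (R::real).
        prob_Rn d P \<and> supp_Rn d P \<subseteq> cball_Rn d R \<and> fluct_const d P t < \<infinity> \<longrightarrow>
          UD_with d P (2 * exp (4 * exp t * (enn2real (fluct_const d P t))\<^sup>2 / (exp t - 1)\<^sup>2
                                + norm_gap d P / (2 * (exp t - 1))))
          \<and> norm_gap d P \<le> R\<^sup>2)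
     \<and> (\<forall>(d::nat) P.
        prob_Rn d P \<and> compactin (Euclidean_space d) (supp_Rn d P) \<longrightarrow>
          (UD d P \<longleftrightarrow> fluct_const d P t < \<infinity>))
     \<and> (\<forall>(I::'i set) (dm::'i \<Rightarrow> nat) P.
        (\<forall>i\<in>I. prob_Rn (dm i) (P i)) \<and> (\<exists>R. \<forall>i\<in>I. supp_Rn (dm i) (P i) \<subseteq> cball_Rn (dm i) R) \<longrightarrow>
          (UD_family I dm P \<longleftrightarrow> (SUP i\<in>I. fluct_const (dm i) (P i) t) < \<infinity>))"
proof (intro conjI allI impI; (elim conjE)?)
  fix d P and R :: real
  assume "prob_Rn d P" "supp_Rn d P \<subseteq> cball_Rn d R" and C: "fluct_const d P t < \<infinity>"
  then interpret bounded_target d P R by unfold_locales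
  show "UD_with d P (2 * exp (4 * exp t * (enn2real (fluct_const d P t))\<^sup>2 / (exp t - 1)\<^sup>2
      + norm_gap d P / (2 * (exp t - 1))))"
    by (rule fluct_const_finite_imp_UD_with[OF assms C])
  show "norm_gap d P \<le> R\<^sup>2"
    by (rule norm_gap_bounds)
next
  fix d P
  assume P: "prob_Rn d P" "compactin (Euclidean_space d) (supp_Rn d P)"
  obtain R where "supp_Rn d P \<subseteq> cball_Rn d R"
    using compactin_imp_subset_cball_Rn[OF P(2)] .
  then interpret bounded_target d P R using P(1) by unfold_locales
  show "UD d P \<longleftrightarrow> fluct_const d P t < \<infinity>"
  proof
    assume "UD d P"
    then obtain D where "UD_with d P D"
      by (auto simp: UD_def)
    from UD_with_imp_fluct_const_le[OF assms this] show "fluct_const d P t < \<infinity>"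
      by (rule le_less_trans) simp
  next
    assume "fluct_const d P t < \<infinity>"
    then show "UD d P"
      using fluct_const_finite_imp_UD_with[OF assms] by (auto simp: UD_def)
  qed
next
  fix I :: "'i set" and dm :: "'i \<Rightarrow> nat" and P
  assume "\<forall>i\<in>I. prob_Rn (dm i) (P i)" "\<exists>R. \<forall>i\<in>I. supp_Rn (dm i) (P i) \<subseteq> cball_Rn (dm i) R"
  then obtain R where targets: "\<And>i. i \<in> I \<Longrightarrow> bounded_target (dm i) (P i) R"
    by (auto simp: bounded_target_def)
  show "UD_family I dm P \<longleftrightarrow> (SUP i\<in>I. fluct_const (dm i) (P i) t) < \<infinity>"
  proof
    assume "UD_family I dm P"
    then obtain D where "\<And>i. i \<in> I \<Longrightarrow> UD_with (dm i) (P i) D"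
      by (auto simp: UD_family_def)
    \<comment> \<open>The bound does not depend on \<open>i\<close>, so it passes to the
      supremum.\<close>
    then have "(SUP i\<in>I. fluct_const (dm i) (P i) t) \<le> ennreal (sqrt (exp 1 *
        (\<Sum>k. doubling_series (D * exp (R\<^sup>2 / (2 * (exp t - 1)))) k) * ((exp t - 1)\<^sup>2 / exp t)))"
      by (intro SUP_least bounded_target.UD_with_imp_fluct_const_le[OF targets assms])
    then show "(SUP i\<in>I. fluct_const (dm i) (P i) t) < \<infinity>"
      by (rule le_less_trans) simp
  next
    let ?C = "SUP i\<in>I. fluct_const (dm i) (P i) t"
    assume C: "?C < \<infinity>"
    \<comment> \<open>Each fluctuation constant is enlarged to the supremum \<open>?C\<close> and
      each \<open>norm_gap\<close> to \<open>R ^ 2\<close>, which gives one constant for the whole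
      family.\<close>
    have "UD_with (dm i) (P i) (2 * exp (4 * exp t * (enn2real ?C)\<^sup>2 / (exp t - 1)\<^sup>2
        + R\<^sup>2 / (2 * (exp t - 1))))" if "i \<in> I" for i
    proof -
      interpret bounded_target "dm i" "P i" R by (rule targets[OF that])
      have le: "fluct_const (dm i) (P i) t \<le> ?C"
        using that by (rule SUP_upper)
      then have "fluct_const (dm i) (P i) t < \<infinity>"
        using C by (rule le_less_trans)
      moreover have "enn2real (fluct_const (dm i) (P i) t) \<le> enn2real ?C"
        using le C by (intro enn2real_mono) auto
      ultimately show ?thesis
        using assms norm_gap_bounds(2)
        by (intro UD_with_mono[OF fluct_const_finite_imp_UD_with[OF assms]])
           (auto intro!: add_mono divide_right_mono mult_left_mono power_mono)
    qed
    then show "UD_family I dm P"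
      unfolding UD_family_def by blast
  qed
qed

end
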